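(* Let $\Bbbk$ be a field of characteristic zero, $H=\Bbbk[\partial]$, and let $V=\mathrm{Cur}_1=Hv$ be the Novikov conformal algebra which is a free $H$-module of rank one with $v\circ_{(\lambda)}v=v$. Then $H^2(V,V)=\Bbbk\,\bar\omega$, where $\omega\in Z^2(V,V)$ is determined by $\omega_\lambda(v,v)=(\partial+\lambda)v$ and $\bar\omega=\omega+B^2(V,V)$.
   Context: A conformal algebra is an $H$-module $V$ with a $\Bbbk$-bilinear operation $V\times V\to V[\lambda]$, $(a,b)\mapsto a\circ_{(\lambda)}b$, which is sesqui-linear: $(\partial a)\circ_{(\lambda)}b=-\lambda(a\circ_{(\lambda)}b)$, $a\circ_{(\lambda)}(\partial b)=(\partial+\lambda)(a\circ_{(\lambda)}b)$. If $a\circ_{(\lambda)}b=\sum_n\lambda^n c_n$, put $\{a\circ_{(\lambda)}b\}=a\circ_{(-\partial-\lambda)}b:=\sum_n(-\partial-\lambda)^nc_n$. It is a Novikov conformal algebra if for all $a,b,c\in V$ (products extended coefficientwise) $$(a\circ_{(\lambda)}b)\circ_{(\lambda+\mu)}c-a\circ_{(\lambda)}(b\circ_{(\mu)}c)=(b\circ_{(\mu)}a)\circ_{(\lambda+\mu)}c-b\circ_{(\mu)}(a\circ_{(\lambda)}c),$$ $$(a\circ_{(\lambda)}b)\circ_{(\mu)}c=\{(a\circ_{(\lambda)}c)\circ_{(\mu-\lambda)}b\}.$$ For a Novikov conformal algebra $V$, $Z^2(V,V)$ is the space of all $\Bbbk$-linear maps $f_\lambda:V\otimes V\to V[\lambda]$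 such that for all $u,v,w\in V$ $$f_\lambda(\partial u,v)=-\lambda f_\lambda(u,v),\qquad f_\lambda(u,\partial v)=(\lambda+\partial)f_\lambda(u,v);$$ $$u\circ_{(\lambda)}f_\mu(v,w)-f_{\lambda+\mu}(u\circ_{(\lambda)}v,w)+f_\lambda(u,v\circ_{(\mu)}w)-f_\lambda(u,v)\circ_{(\lambda+\mu)}w$$ $$=v\circ_{(\mu)}f_\lambda(u,w)-f_{\lambda+\mu}(v\circ_{(\mu)}u,w)+f_\mu(v,u\circ_{(\lambda)}w)-f_\mu(v,u)\circ_{(\lambda+\mu)}w;$$ $$f_{\lambda+\mu}(u\circ_{(\lambda)}v,w)+f_\lambda(u,v)\circ_{(\lambda+\mu)}w=\{f_\lambda(u,w)\circ_{(\mu)}v\}+f_{-\partial-\mu}(u\circ_{(\lambda)}w,v).$$ All maps are extended coefficientwise to polynomials, and $f_{-\partial-\mu}(x,y):=\sum_n(-\partial-\mu)^nc_n$ if $f_\lambda(x,y)=\sum_n\lambda^nc_n$. $B^2(V,V)\subseteq Z^2(V,V)$ is the subspace of all $d^1\tau$, where $\tau:V\to V$ is $H$-linear and $(d^1\tau)_\lambda(u,v)=u\circ_{(\lambda)}\tau(v)-\tau(u\circ_{(\lambda)}v)+\tau(u)\circ_{(\lambda)}v$. Finally $H^2(V,V)=Z^2(V,V)/B^2(V,V)$ (this space describes infinitesimal conformal deformations of $V$ up to equivalence). A map satisfying the first pair of relations on $V=Hv$ is completely determined by its value at $(v,v)$. *)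

theory Defs
  imports
    "HOL-Computational_Algebra.Polynomial"
    "HOL-Library.Function_Algebras"
    "HOL-Library.Set_Algebras"
begin

text \<open>
  The ring \<open>H = k[\<partial>]\<close> is the type \<open>'k poly\<close>, and an \<open>H\<close>-module is an instance of the locale
  \<^locale>\<open>module\<close> with a scaling \<open>s\<close>. For a module \<open>V\<close> on the type \<open>'v\<close>,
  \<open>V[\<lambda>]\<close> is \<open>'v poly\<close> and \<open>V[\<lambda>,\<mu>]\<close> is \<open>'v poly poly\<close>, with outer variable \<open>\<mu>\<close> and inner
  variable \<open>\<lambda>\<close>. Likewise \<open>H[\<lambda>]\<close> is \<open>'k poly poly\<close> and \<open>H[\<lambda>,\<mu>]\<close> is \<open>'k poly poly poly\<close>.
\<close>

text \<open>The action of \<open>R[x]\<close> on \<open>M[x]\<close> induced by an action of \<open>R\<close> on \<open>M\<close>.\<close>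

definition poly_scale :: "('h::zero \<Rightarrow> 'v \<Rightarrow> 'v) \<Rightarrow> 'h poly \<Rightarrow> 'v poly \<Rightarrow> 'v::comm_monoid_add poly" where
  "poly_scale s P p =
     (\<Sum>i\<le>degree P. \<Sum>j\<le>degree p. monom (s (coeff P i) (coeff p j)) (i + j))"

text \<open>\<open>\<partial>\<close> as an element of \<open>H\<close>; \<open>\<partial>\<close> and \<open>\<lambda>\<close> as elements of \<open>H[\<lambda>]\<close>; \<open>\<partial>\<close>, \<open>\<lambda>\<close> and \<open>\<mu>\<close> as elements
  of \<open>H[\<lambda>,\<mu>]\<close>.\<close>

abbreviation pd0 :: "'k::comm_ring_1 poly" where "pd0 \<equiv> [:0, 1:]"

abbreviation pd1 :: "'k::comm_ring_1 poly poly" where "pd1 \<equiv> [:[:0, 1:]:]"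
abbreviation lam1 :: "'k::comm_ring_1 poly poly" where "lam1 \<equiv> [:0, 1:]"

abbreviation pd2 :: "'k::comm_ring_1 poly poly poly" where "pd2 \<equiv> [:[:[:0, 1:]:]:]"
abbreviation lam2 :: "'k::comm_ring_1 poly poly poly" where "lam2 \<equiv> [:[:0, 1:]:]"
abbreviation mu2 :: "'k::comm_ring_1 poly poly poly" where "mu2 \<equiv> [:0, 1:]"

abbreviation const2 :: "'v::zero \<Rightarrow> 'v poly poly" where "const2 a \<equiv> [:[:a:]:]"

definition sesquilinear :: "('k::field poly \<Rightarrow> 'v \<Rightarrow> 'v) \<Rightarrow> ('v \<Rightarrow> 'v \<Rightarrow> 'v::ab_group_add poly) \<Rightarrow> bool" where
  "sesquilinear s f \<longleftrightarrow>
     (\<forall>b. Vector_Spaces.linear (\<lambda>c. s [:c:]) (\<lambda>c. poly_scale s [:[:c:]:]) (\<lambda>a. f a b)) \<and>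
     (\<forall>a. Vector_Spaces.linear (\<lambda>c. s [:c:]) (\<lambda>c. poly_scale s [:[:c:]:]) (\<lambda>b. f a b)) \<and>
     (\<forall>a b. f (s pd0 a) b = poly_scale s (- lam1) (f a b)) \<and>
     (\<forall>a b. f a (s pd0 b) = poly_scale s (pd1 + lam1) (f a b))"

text \<open>
  \<open>at_param s f X a b\<close> is \<open>f\<^sub>X(a,b)\<close>, i.e. \<open>\<Sum>\<^sub>n X\<^sup>n c\<^sub>n\<close> in \<open>V[\<lambda>,\<mu>]\<close> where \<open>f\<^sub>\<lambda>(a,b) = \<Sum>\<^sub>n \<lambda>\<^sup>n c\<^sub>n\<close>.
  The parameter \<open>X\<close> in \<open>H[\<lambda>,\<mu>]\<close> may involve \<open>\<partial>\<close>, which then acts on the coefficients \<open>c\<^sub>n\<close>; so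
  \<open>{a \<circ>\<^sub>(\<^sub>\<nu>\<^sub>) b}\<close> is the product at the parameter \<open>- \<partial> - \<nu>\<close>.
  The operation \<open>ext_param\<close> extends this coefficientwise to arguments in \<open>V[\<lambda>,\<mu>]\<close>.
\<close>

definition at_param ::
    "('k::field poly \<Rightarrow> 'v \<Rightarrow> 'v) \<Rightarrow> ('v \<Rightarrow> 'v \<Rightarrow> 'v::ab_group_add poly) \<Rightarrow>
     'k poly poly poly \<Rightarrow> 'v \<Rightarrow> 'v \<Rightarrow> 'v poly poly" where
  "at_param s f X a b =
     (\<Sum>n\<le>degree (f a b). poly_scale (poly_scale s) (X ^ n) (const2 (coeff (f a b) n)))"

definition ext_param ::
    "('k::field poly \<Rightarrow> 'v \<Rightarrow> 'v) \<Rightarrow> ('v \<Rightarrow> 'v \<Rightarrow> 'v::ab_group_add poly) \<Rightarrow>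
     'k poly poly poly \<Rightarrow> 'v poly poly \<Rightarrow> 'v poly poly \<Rightarrow> 'v poly poly" where
  "ext_param s f X P Q =
     (\<Sum>i\<le>degree P. \<Sum>j\<le>degree (coeff P i). \<Sum>k\<le>degree Q. \<Sum>l\<le>degree (coeff Q k).
        poly_scale (poly_scale s) (mu2 ^ (i + k) * lam2 ^ (j + l))
          (at_param s f X (coeff (coeff P i) j) (coeff (coeff Q k) l)))"

locale conformal_algebra = module s
  for s :: "'k::field poly \<Rightarrow> 'v::ab_group_add \<Rightarrow> 'v" +
  fixes m :: "'v \<Rightarrow> 'v \<Rightarrow> 'v poly"
  assumes sesquilinear: "sesquilinear s m"

locale novikov_conformal_algebra = conformal_algebra s m
  for s :: "'k::field poly \<Rightarrow> 'v::ab_group_add \<Rightarrow> 'v" and m :: "'v \<Rightarrow> 'v \<Rightarrow> 'v poly" +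
  assumes left_symmetric:
    "ext_param s m (lam2 + mu2) (ext_param s m lam2 (const2 a) (const2 b)) (const2 c)
       - ext_param s m lam2 (const2 a) (ext_param s m mu2 (const2 b) (const2 c)) =
     ext_param s m (lam2 + mu2) (ext_param s m mu2 (const2 b) (const2 a)) (const2 c)
       - ext_param s m mu2 (const2 b) (ext_param s m lam2 (const2 a) (const2 c))"
  and right_commutative:
    "ext_param s m mu2 (ext_param s m lam2 (const2 a) (const2 b)) (const2 c) =
     ext_param s m (- pd2 - (mu2 - lam2)) (ext_param s m lam2 (const2 a) (const2 c)) (const2 b)"

definition Z2 ::
    "('k::field poly \<Rightarrow> 'v \<Rightarrow> 'v) \<Rightarrow> ('v \<Rightarrow> 'v \<Rightarrow> 'v::ab_group_add poly) \<Rightarrow>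
     ('v \<Rightarrow> 'v \<Rightarrow> 'v poly) set" where
  "Z2 s m = {f. sesquilinear s f \<and>
     (\<forall>u' v' w'. let u = const2 u'; v = const2 v'; w = const2 w' in
        ext_param s m lam2 u (ext_param s f mu2 v w) - ext_param s f (lam2 + mu2) (ext_param s m lam2 u v) w
          + ext_param s f lam2 u (ext_param s m mu2 v w) - ext_param s m (lam2 + mu2) (ext_param s f lam2 u v) w =
        ext_param s m mu2 v (ext_param s f lam2 u w) - ext_param s f (lam2 + mu2) (ext_param s m mu2 v u) w
          + ext_param s f mu2 v (ext_param s m lam2 u w) - ext_param s m (lam2 + mu2) (ext_param s f mu2 v u) w \<and>
        ext_param s f (lam2 + mu2) (ext_param s m lam2 u v) w + ext_param s m (lam2 + mu2) (ext_param s f lam2 u v) w =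
        ext_param s m (- pd2 - mu2) (ext_param s f lam2 u w) v + ext_param s f (- pd2 - mu2) (ext_param s m lam2 u w) v)}"

definition d1 ::
    "('v \<Rightarrow> 'v \<Rightarrow> 'v::ab_group_add poly) \<Rightarrow> ('v \<Rightarrow> 'v) \<Rightarrow> 'v \<Rightarrow> 'v \<Rightarrow> 'v poly" where
  "d1 m \<tau> u v = m u (\<tau> v) - map_poly \<tau> (m u v) + m (\<tau> u) v"

definition B2 ::
    "('k::field poly \<Rightarrow> 'v \<Rightarrow> 'v) \<Rightarrow> ('v \<Rightarrow> 'v \<Rightarrow> 'v::ab_group_add poly) \<Rightarrow>
     ('v \<Rightarrow> 'v \<Rightarrow> 'v poly) set" where
  "B2 s m = {d1 m \<tau> | \<tau>. module_hom s s \<tau>}"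

definition H2 ::
    "('k::field poly \<Rightarrow> 'v \<Rightarrow> 'v) \<Rightarrow> ('v \<Rightarrow> 'v \<Rightarrow> 'v::ab_group_add poly) \<Rightarrow>
     ('v \<Rightarrow> 'v \<Rightarrow> 'v poly) set set" where
  "H2 s m = (\<lambda>f. f +o B2 s m) ` Z2 s m"

text \<open>Scalar multiplication on \<open>H\<^sup>2\<close>: it sends the coset \<open>f + B\<^sup>2\<close> to \<open>c f + B\<^sup>2\<close>. The summand
  \<open>B\<^sup>2\<close> is needed for \<open>c = 0\<close>.\<close>

definition scale_map ::
    "('k::field poly \<Rightarrow> 'v \<Rightarrow> 'v) \<Rightarrow> 'k \<Rightarrow> ('v \<Rightarrow> 'v \<Rightarrow> 'v::ab_group_add poly) \<Rightarrow> 'v \<Rightarrow> 'v \<Rightarrow> 'v poly" where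
  "scale_map s c f = (\<lambda>u v. poly_scale s [:[:c:]:] (f u v))"

definition scale_class ::
    "('k::field poly \<Rightarrow> 'v \<Rightarrow> 'v) \<Rightarrow> ('v \<Rightarrow> 'v \<Rightarrow> 'v::ab_group_add poly) \<Rightarrow> 'k \<Rightarrow>
     ('v \<Rightarrow> 'v \<Rightarrow> 'v poly) set \<Rightarrow> ('v \<Rightarrow> 'v \<Rightarrow> 'v poly) set" where
  "scale_class s m c A = scale_map s c ` A + B2 s m"

text \<open>\<open>V = Hv\<close> is the Novikov conformal algebra \<open>Cur\<^sub>1\<close>: \<open>{v}\<close> is a basis of the \<open>H\<close>-module \<open>V\<close>,
  and \<open>v \<circ>\<^sub>(\<^sub>\<lambda>\<^sub>) v = v\<close>.\<close>

locale Cur1 = novikov_conformal_algebra s m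
  for s :: "'k::field poly \<Rightarrow> 'v::ab_group_add \<Rightarrow> 'v" and m :: "'v \<Rightarrow> 'v \<Rightarrow> 'v poly" +
  fixes v :: 'v
  assumes independent: "independent {v}"
    and span: "span {v} = UNIV"
    and mult: "m v v = [:v:]"

text \<open>The locale \<open>Cur1\<close> is satisfiable: on \<open>V = k[\<partial>]\<close> with \<open>v = 1\<close> one takes
  \<open>a \<circ>\<^sub>(\<^sub>\<lambda>\<^sub>) b = a(- \<lambda>) b(\<partial> + \<lambda>)\<close>.\<close>

definition is_ring_hom :: "('a::comm_ring_1 \<Rightarrow> 'b::comm_ring_1) \<Rightarrow> bool" where
  "is_ring_hom h \<longleftrightarrow> h 0 = 0 \<and> h 1 = 1 \<and> (\<forall>x y. h (x + y) = h x + h y) \<and> (\<forall>x y. h (x * y) = h x * h y)"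

definition subst_poly :: "('a::comm_ring_1 \<Rightarrow> 'b::comm_ring_1) \<Rightarrow> 'b \<Rightarrow> 'a poly \<Rightarrow> 'b" where
  "subst_poly h x p = poly (map_poly h p) x"

lemma subst_poly_pCons:
  "is_ring_hom h \<Longrightarrow> subst_poly h x (pCons a p) = h a + x * subst_poly h x p"
  by (simp add: subst_poly_def map_poly_pCons is_ring_hom_def)

lemma subst_poly_0 [simp]: "subst_poly h x 0 = 0"
  by (simp add: subst_poly_def)

lemma subst_poly_hom:
  assumes h: "is_ring_hom h"
  shows "is_ring_hom (subst_poly h x)"
proof -
  note [simp] = subst_poly_pCons[OF h]
  have h': "h 0 = 0" "h 1 = 1" "h (a + b) = h a + h b" "h (a * b) = h a * h b" for a b
    using h by (auto simp: is_ring_hom_def)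
  have add: "subst_poly h x (p + q) = subst_poly h x p + subst_poly h x q" for p q
    by (induction p q rule: poly_induct2) (simp_all add: h' algebra_simps)
  have smult: "subst_poly h x (smult a q) = h a * subst_poly h x q" for a q
    by (induction q) (simp_all add: h' algebra_simps)
  have mult: "subst_poly h x (p * q) = subst_poly h x p * subst_poly h x q" for p q
    by (induction p) (simp_all add: add smult h' algebra_simps)
  show ?thesis
    using add mult unfolding is_ring_hom_def by (simp add: one_pCons h')
qed

lemma subst_poly_altdef:
  assumes "is_ring_hom h"
  shows "subst_poly h x p = (\<Sum>i\<le>degree p. x ^ i * h (coeff p i))"
proof -
  have h0: "h 0 = 0" using assms by (simp add: is_ring_hom_def)
  have "subst_poly h x p = (\<Sum>i\<le>degree (map_poly h p). x ^ i * h (coeff p i))"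
    by (simp add: subst_poly_def poly_altdef coeff_map_poly h0 mult.commute)
  also have "\<dots> = (\<Sum>i\<le>degree p. x ^ i * h (coeff p i))"
  proof (rule sum.mono_neutral_left)
    show "\<forall>i\<in>{..degree p} - {..degree (map_poly h p)}. x ^ i * h (coeff p i) = 0"
    proof
      fix i assume "i \<in> {..degree p} - {..degree (map_poly h p)}"
      then have "coeff (map_poly h p) i = 0" by (intro coeff_eq_0) simp
      then show "x ^ i * h (coeff p i) = 0" by (simp add: coeff_map_poly h0)
    qed
  qed (simp_all add: map_poly_degree_leq)
  finally show ?thesis .
qed

lemma subst_poly_subst_poly:
  assumes "is_ring_hom g" "is_ring_hom h" "is_ring_hom k" "\<And>c. g (h c) = k c"
  shows "g (subst_poly h x p) = subst_poly k (g x) p"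
proof (induction p)
  case 0
  then show ?case using assms(1) by (simp add: is_ring_hom_def)
next
  case (pCons a p)
  then show ?case using assms
    by (simp add: subst_poly_pCons) (simp add: is_ring_hom_def)
qed

lemma const_hom: "is_ring_hom (\<lambda>c. [:c:])"
  by (simp add: is_ring_hom_def one_pCons)

lemma comp_hom: "is_ring_hom g \<Longrightarrow> is_ring_hom h \<Longrightarrow> is_ring_hom (\<lambda>c. g (h c))"
  by (simp add: is_ring_hom_def)

lemma poly_scale_times: "poly_scale (*) P p = P * p"
proof -
  have "P * p = (\<Sum>i\<le>degree P. monom (coeff P i) i) * (\<Sum>j\<le>degree p. monom (coeff p j) j)"
    by (simp add: poly_as_sum_of_monoms)
  also have "\<dots> = poly_scale (*) P p"
    by (simp add: poly_scale_def sum_product mult_monom)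
  finally show ?thesis by simp
qed

abbreviation const3 :: "'k::zero \<Rightarrow> 'k poly poly poly" where "const3 c \<equiv> [:[:[:c:]:]:]"

lemma c_hom: "is_ring_hom const2" "is_ring_hom const3"
  using comp_hom[OF const_hom const_hom] comp_hom[OF const_hom comp_hom[OF const_hom const_hom]] .

definition cur1 :: "'k::field poly \<Rightarrow> 'k poly \<Rightarrow> 'k poly poly" where
  "cur1 a b = subst_poly const2 (- lam1) a * subst_poly const2 (pd1 + lam1) b"

abbreviation S2 :: "'k::field poly poly poly \<Rightarrow> 'k poly \<Rightarrow> 'k poly poly poly" where
  "S2 \<equiv> subst_poly const3"

definition E2 :: "'k::field poly poly poly \<Rightarrow> 'k poly poly poly \<Rightarrow> 'k poly poly poly" where
  "E2 Y = subst_poly (subst_poly (S2 Y) lam2) mu2"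

lemma S2_hom: "is_ring_hom (S2 Y)" and E2_hom: "is_ring_hom (E2 Y)"
  unfolding E2_def by (intro subst_poly_hom c_hom)+

lemma hom_simps:
  assumes "is_ring_hom h"
  shows "h 0 = 0" "h 1 = 1" "h (x + y) = h x + h y" "h (x * y) = h x * h y"
    "h (- x) = - h x" "h (x - y) = h x - h y"
proof -
  show *: "h 0 = 0" "h 1 = 1" "h (x + y) = h x + h y" "h (x * y) = h x * h y" for x y
    using assms by (auto simp: is_ring_hom_def)
  show m: "h (- x) = - h x" for x
    using *(3)[of x "- x"] *(1) by (simp add: eq_neg_iff_add_eq_0 add.commute)
  show "h (x - y) = h x - h y"
    using *(3)[of x "- y"] m by simp
qed

lemma at_param_cur1: "at_param (*) cur1 X a b = S2 (- X) a * S2 (pd2 + X) b"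
proof -
  let ?e = "subst_poly (\<lambda>h. [:[:h:]:]) X"
  note e = subst_poly_hom[OF c_hom(1), of X]
  have ef: "(poly_scale (poly_scale (*)) :: 'a poly poly poly \<Rightarrow> _) = (*)"
    by (intro ext) (simp add: poly_scale_times[abs_def])
  have "at_param (*) cur1 X a b = ?e (cur1 a b)"
    by (simp add: at_param_def ef subst_poly_altdef c_hom)
  also have "\<dots> = ?e (subst_poly const2 (- lam1) a) * ?e (subst_poly const2 (pd1 + lam1) b)"
    by (simp add: cur1_def hom_simps[OF e])
  also have "?e (subst_poly const2 (- lam1) a) = S2 (?e (- lam1)) a"
    by (rule subst_poly_subst_poly[OF e c_hom]) (simp add: subst_poly_pCons[OF c_hom(1)])
  also have "?e (subst_poly const2 (pd1 + lam1) b) = S2 (?e (pd1 + lam1)) b"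
    by (rule subst_poly_subst_poly[OF e c_hom]) (simp add: subst_poly_pCons[OF c_hom(1)])
  also have "?e (- lam1) = - X"
    by (simp only: hom_simps[OF e] subst_poly_pCons[OF c_hom(1)]) (simp flip: one_pCons)
  also have "?e (pd1 + lam1) = pd2 + X"
    by (simp only: hom_simps[OF e] subst_poly_pCons[OF c_hom(1)]) (simp flip: one_pCons)
  finally show ?thesis .
qed

lemma E2_altdef:
  "E2 Y P = (\<Sum>i\<le>degree P. \<Sum>j\<le>degree (coeff P i). mu2 ^ i * lam2 ^ j * S2 Y (coeff (coeff P i) j))"
  by (simp add: E2_def subst_poly_altdef subst_poly_hom c_hom sum_distrib_left mult.assoc)

lemma ext_param_cur1: "ext_param (*) cur1 X P Q = E2 (- X) P * E2 (pd2 + X) Q"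
proof -
  have ef: "(poly_scale (poly_scale (*)) :: 'a poly poly poly \<Rightarrow> _) = (*)"
    by (intro ext) (simp add: poly_scale_times[abs_def])
  have "E2 (- X) P * E2 (pd2 + X) Q =
    (\<Sum>i\<le>degree P. \<Sum>j\<le>degree (coeff P i).
       (mu2 ^ i * lam2 ^ j * S2 (- X) (coeff (coeff P i) j)) * E2 (pd2 + X) Q)"
    by (subst E2_altdef) (simp only: sum_distrib_right)
  also have "\<dots> = ext_param (*) cur1 X P Q"
    unfolding ext_param_def ef at_param_cur1 E2_altdef[of "pd2 + X"] sum_distrib_left
    by (intro sum.cong refl) (simp only: power_add mult_ac)
  finally show ?thesis by simp
qed

lemma E2_simps:
  "E2 Y mu2 = mu2" "E2 Y lam2 = lam2" "S2 Y pd0 = Y" "E2 Y (S2 Z a) = S2 (E2 Y Z) a"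
  "E2 Y (const2 a) = S2 Y a"
proof -
  note h = c_hom(2) subst_poly_hom[OF c_hom(2)] subst_poly_hom[OF subst_poly_hom[OF c_hom(2)]]
    subst_poly_hom[OF subst_poly_hom[OF subst_poly_hom[OF c_hom(2)]]]
  show "E2 Y mu2 = mu2" "E2 Y lam2 = lam2" "S2 Y pd0 = Y" "E2 Y (const2 a) = S2 Y a"
    by (simp_all add: E2_def subst_poly_pCons h hom_simps[OF h(1)] hom_simps[OF h(2)] hom_simps[OF h(3)] hom_simps[OF h(4)] flip: one_pCons)
  show "E2 Y (S2 Z a) = S2 (E2 Y Z) a"
    by (rule subst_poly_subst_poly[OF E2_hom c_hom(2) c_hom(2)])
       (simp add: E2_def subst_poly_pCons h)
qed

lemma sesquilinear_cur1: "sesquilinear (*) cur1"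
proof -
  note h = subst_poly_hom[OF c_hom(1)]
  have C: "subst_poly const2 Y [:c:] = [:[:c:]:]" and D: "subst_poly const2 Y pd0 = Y" for Y :: "'a poly poly" and c
    by (simp_all add: subst_poly_pCons[OF c_hom(1)] hom_simps[OF h] flip: one_pCons)
  have K: "[:x + y:] = [:x:] + [:y:]" "[:x * y:] = [:x:] * [:y:]" for x y :: "'b::comm_ring_1"
    by simp_all
  have vs: "vector_space (\<lambda>c. (*) [:c:] :: 'a poly \<Rightarrow> _)" "vector_space (\<lambda>c. (*) [:[:c:]:] :: 'a poly poly \<Rightarrow> _)"
    unfolding vector_space_def by (simp_all only: K distrib_left distrib_right mult.assoc) (simp_all flip: one_pCons)
  have L: "Vector_Spaces.linear (\<lambda>c. (*) [:c:]) (\<lambda>c. (*) [:[:c:]:]) g"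
    if "\<And>x y. g (x + y) = g x + g y" "\<And>c x. g ([:c:] * x) = [:[:c:]:] * g x" for g :: "'a poly \<Rightarrow> 'a poly poly"
    unfolding Vector_Spaces.linear_def module_hom_def module_hom_axioms_def module_iff_vector_space
    using vs that by blast
  have "Vector_Spaces.linear (\<lambda>c. (*) [:c:]) (\<lambda>c. poly_scale (*) [:[:c:]:]) (\<lambda>a. cur1 a b)"
    "Vector_Spaces.linear (\<lambda>c. (*) [:c:]) (\<lambda>c. poly_scale (*) [:[:c:]:]) (\<lambda>a. cur1 b a)" for b :: "'a poly"
    unfolding poly_scale_times
    by (rule L; simp only: cur1_def hom_simps[OF h] C distrib_left distrib_right mult_ac)+
  then show ?thesis
    by (simp add: sesquilinear_def poly_scale_times cur1_def hom_simps[OF h] D del: mult_pCons_left mult_pCons_right)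
qed

lemma Cur1_cur1: "Cur1 (*) cur1 (1 :: 'k::field poly)"
proof -
  interpret module "(*) :: 'k poly \<Rightarrow> _"
    by standard (simp_all add: algebra_simps)
  note s = ext_param_cur1 hom_simps[OF E2_hom] hom_simps[OF S2_hom] E2_simps
  have e: "x + - (y + x) = - y" "x + - (x + y) = - y"
    "x + - (x + - y - z) = z + y" "x + (y + - y) - z = - z + x" for x y z :: "'k poly poly poly"
    by simp_all
  show ?thesis
  proof
    show "sesquilinear (*) (cur1 :: 'k poly \<Rightarrow> _)"
      by (rule sesquilinear_cur1)
    show "independent {1 :: 'k poly}"
      by (auto simp: independent_explicit_module subset_singleton_iff)
    show "span {1 :: 'k poly} = UNIV"
      by (auto simp: span_singleton)
    show "cur1 1 1 = [:1 :: 'k poly:]"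
      by (simp add: cur1_def hom_simps[OF subst_poly_hom[OF c_hom(1)]] flip: one_pCons)
  next
    fix a b c :: "'k poly"
    show "ext_param (*) cur1 (lam2 + mu2) (ext_param (*) cur1 lam2 (const2 a) (const2 b)) (const2 c)
       - ext_param (*) cur1 lam2 (const2 a) (ext_param (*) cur1 mu2 (const2 b) (const2 c)) =
     ext_param (*) cur1 (lam2 + mu2) (ext_param (*) cur1 mu2 (const2 b) (const2 a)) (const2 c)
       - ext_param (*) cur1 mu2 (const2 b) (ext_param (*) cur1 lam2 (const2 a) (const2 c))"
      unfolding s by (simp only: algebra_simps e)
    show "ext_param (*) cur1 mu2 (ext_param (*) cur1 lam2 (const2 a) (const2 b)) (const2 c) =
     ext_param (*) cur1 (- pd2 - (mu2 - lam2)) (ext_param (*) cur1 lam2 (const2 a) (const2 c)) (const2 b)"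
      unfolding s by (simp only: algebra_simps e)
  qed
qed

end

theory Submission
  imports Defs
begin

text \<open>
  The module \<open>V\<close> is free on \<open>v\<close>, so \<open>a \<mapsto> a v\<close> identifies it with \<open>H = k[\<partial>]\<close>. Under this identification a
  sesquilinear map is \<open>f\<^sub>\<lambda>(a,b) = a(- \<lambda>) b(\<partial> + \<lambda>) F(\<partial>,\<lambda>)\<close> for a unique polynomial \<open>F\<close>, its symbol:
  the value at \<open>(v,v)\<close> is \<open>F v\<close>. The product of \<open>Cur\<^sub>1\<close> has the symbol \<open>1\<close>.

  Substituting this shape into the definition of \<open>Z\<^sup>2\<close>, all terms acquire the common factor
  \<open>a(- \<lambda>) b(- \<mu>) c(\<partial> + \<lambda> + \<mu>)\<close>, and \<open>F\<close> is the symbol of a cocycle iff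
  \<open>F(\<partial> + \<lambda>, \<mu>) + F(\<partial>,\<lambda>) - F(- \<lambda> - \<mu>, \<lambda>)\<close> is symmetric in \<open>\<lambda>\<close> and \<open>\<mu>\<close>, and
  \<open>F(\<partial>, \<lambda> + \<mu>) + F(- \<lambda> - \<mu>, \<lambda>) = F(\<partial> + \<mu>, \<lambda>) + F(\<partial>, - \<partial> - \<mu>)\<close> (lemma \<open>of_symbol_in_Z2_iff\<close>). The
  coboundaries are the maps with symbol \<open>t(\<partial> + \<lambda>) - t(\<partial>) + t(- \<lambda>)\<close>, \<open>t \<in> H\<close> (lemma \<open>B2_eq\<close>). So the
  theorem is about polynomials in two variables.

  At \<open>\<mu> = 0\<close> the first identity forces \<open>F(\<partial>,0) = a + b \<partial>\<close> (lemma \<open>cocycle_symbol_coeff_0_affine\<close>). The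
  derivative of the second identity at \<open>\<lambda> = 0\<close>, taken with \<open>\<lambda> + \<mu>\<close> fixed, expresses the partial derivative
  \<open>F\<^sub>\<lambda>\<close> by \<open>b\<close> and the polynomial \<open>q = F\<^sub>\<lambda>(\<partial>,0)\<close> of one variable. Integrating with respect to \<open>\<lambda>\<close>, which
  needs characteristic zero, shows that \<open>F\<close> is \<open>b (\<partial> + \<lambda>)\<close> plus the coboundary of an antiderivative of \<open>q\<close>
  (lemma \<open>cocycle_symbol_decompose\<close>). Finally \<open>\<partial> + \<lambda>\<close> is not a coboundary: at \<open>\<lambda> = 0\<close> a coboundary symbol
  is constant (lemma \<open>omega_not_coboundary\<close>).
\<close>

section \<open>Additive maps on polynomials\<close>

lemma map_poly_hom:
  fixes \<phi> :: "'a::ab_group_add \<Rightarrow> 'b::ab_group_add"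
  assumes add: "\<And>a b. \<phi> (a + b) = \<phi> a + \<phi> b"
  shows "map_poly \<phi> (p + q) = map_poly \<phi> p + map_poly \<phi> q"
    and "map_poly \<phi> (p - q) = map_poly \<phi> p - map_poly \<phi> q"
    and "map_poly \<phi> (sum P A) = (\<Sum>i\<in>A. map_poly \<phi> (P i))"
proof -
  have 0: "\<phi> 0 = 0" using add[of 0 0] by simp
  have diff: "\<phi> (a - b) = \<phi> a - \<phi> b" for a b
    using add[of "a - b" b] by (simp add: algebra_simps)
  show plus: "map_poly \<phi> (p + q) = map_poly \<phi> p + map_poly \<phi> q" for p q
    by (intro poly_eqI) (simp add: coeff_map_poly 0 add)
  show "map_poly \<phi> (p - q) = map_poly \<phi> p - map_poly \<phi> q"
    by (intro poly_eqI) (simp add: coeff_map_poly 0 diff)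
  show "map_poly \<phi> (sum P A) = (\<Sum>i\<in>A. map_poly \<phi> (P i))"
    by (induction A rule: infinite_finite_induct) (simp_all add: plus)
qed

text \<open>
  An injection intertwining multiplication in a ring with the action \<open>s\<close> does so coefficientwise.
  It is used twice: once to pass from \<open>H\<close> to \<open>H[\<lambda>]\<close> and, with \<open>s\<close> replaced by the resulting
  action, once more to reach \<open>H[\<lambda>,\<mu>]\<close>. Injectivity keeps the degrees, and hence the ranges of the
  defining sums, equal on both sides.
\<close>

lemma poly_scale_transport:
  fixes \<phi> :: "'a::comm_ring_1 \<Rightarrow> 'v::ab_group_add"
  assumes add: "\<And>a b. \<phi> (a + b) = \<phi> a + \<phi> b"
    and inj: "inj \<phi>"
    and scale: "\<And>h a. \<phi> (h * a) = s h (\<phi> a)"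
  shows "poly_scale s P (map_poly \<phi> p) = map_poly \<phi> (P * p)"
proof -
  have 0: "\<phi> 0 = 0" using add[of 0 0] by simp
  have nz: "\<phi> a \<noteq> 0" if "a \<noteq> 0" for a
    using that inj 0 by (metis injD)
  have deg: "degree (map_poly \<phi> p) = degree p"
    by (cases "p = 0") (simp_all add: degree_map_poly nz)
  show ?thesis
    by (simp add: poly_scale_def deg coeff_map_poly 0 map_poly_hom[of \<phi>, OF add] map_poly_monom
        scale flip: poly_scale_times)
qed

section \<open>Sesquilinear maps on a cyclic module\<close>

lemma sesquilinear_simps:
  assumes "sesquilinear s f"
  shows "f (a + a') b = f a b + f a' b" "f a (b + b') = f a b + f a b'"
    "f (s [:c:] a) b = poly_scale s [:[:c:]:] (f a b)"
    "f a (s [:c:] b) = poly_scale s [:[:c:]:] (f a b)"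
    "f (s pd0 a) b = poly_scale s (- lam1) (f a b)"
    "f a (s pd0 b) = poly_scale s (pd1 + lam1) (f a b)"
proof -
  note l = assms[unfolded sesquilinear_def Vector_Spaces.linear_def module_hom_def module_hom_axioms_def]
  show "f (a + a') b = f a b + f a' b" "f a (b + b') = f a b + f a b'"
    "f (s [:c:] a) b = poly_scale s [:[:c:]:] (f a b)"
    "f a (s [:c:] b) = poly_scale s [:[:c:]:] (f a b)"
    "f (s pd0 a) b = poly_scale s (- lam1) (f a b)"
    "f a (s pd0 b) = poly_scale s (pd1 + lam1) (f a b)"
    using l by blast+
qed

text \<open>
  The two relations for \<open>\<partial>\<close> move any polynomial in \<open>\<partial>\<close> out of either argument, so on a cyclic module
  a sesquilinear map is known once its value at the generator is.
\<close>

lemma sesquilinear_eqI: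
  fixes s :: "'k::field poly \<Rightarrow> 'v::ab_group_add \<Rightarrow> 'v"
  assumes "module s"
    and f: "sesquilinear s f" and g: "sesquilinear s g"
    and gen: "module.span s {v} = UNIV"
    and eq: "f v v = g v v"
  shows "f = g"
proof -
  interpret module s by fact
  have split: "s (pCons c p) x = s [:c:] x + s pd0 (s p x)" for c p x
  proof -
    have "pCons c p = [:c:] + pd0 * p" by simp
    then show ?thesis by (metis scale_left_distrib scale_scale)
  qed
  note F = sesquilinear_simps[OF f] and G = sesquilinear_simps[OF g]
  have zero: "f 0 w = 0" "g 0 w = 0" "f w 0 = 0" "g w 0 = 0" for w
    using F(1,2)[of 0 0] G(1,2)[of 0 0] F(1)[of 0 0 w] F(2)[of w 0 0] G(1)[of 0 0 w] G(2)[of w 0 0]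
    by simp_all
  have right: "f v (s b v) = g v (s b v)" for b
  proof (induction b)
    case (pCons c p)
    then show ?case unfolding split[of c p] F G by (simp only: eq)
  qed (simp add: zero)
  have both: "f (s a v) (s b v) = g (s a v) (s b v)" for a b
  proof (induction a)
    case (pCons c p)
    then show ?case unfolding split[of c p] F G by (simp only: right)
  qed (simp add: zero)
  have "\<exists>a. u = s a v" for u
    using gen by (auto simp: span_singleton)
  then show "f = g"
    by (metis both ext)
qed

section \<open>Symbols of cocycles and coboundaries\<close>

text \<open>
  For a symbol \<open>F(\<partial>,\<lambda>)\<close> this is \<open>F(A,B)\<close> in \<open>H[\<lambda>,\<mu>]\<close>.
\<close>

definition symbol_at :: "'k::field poly poly poly \<Rightarrow> 'k poly poly poly \<Rightarrow> 'k poly poly \<Rightarrow> 'k poly poly poly" where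
  "symbol_at A B = subst_poly (S2 A) B"

lemma symbol_at_hom: "is_ring_hom (symbol_at A B)"
  unfolding symbol_at_def by (intro subst_poly_hom c_hom)

lemma E2_symbol_at: "E2 Y (symbol_at A B F) = symbol_at (E2 Y A) (E2 Y B) F"
  unfolding symbol_at_def
  by (rule subst_poly_subst_poly[OF E2_hom S2_hom S2_hom E2_simps(4)])

text \<open>
  The sesquilinear map on \<open>H\<close> with symbol \<open>F\<close> is \<open>(a,b) \<mapsto> a(- \<lambda>) b(\<partial> + \<lambda>) F(\<partial>,\<lambda>)\<close>. At the parameter
  \<open>X\<close> and on arguments in \<open>H[\<lambda>,\<mu>]\<close>, the first argument has \<open>- X\<close> and the second \<open>\<partial> + X\<close> substituted
  for \<open>\<partial>\<close>; the variables \<open>\<lambda>\<close>, \<open>\<mu>\<close> already present in the arguments are left alone.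
\<close>

lemma ext_param_symbol:
  "ext_param (*) (\<lambda>a b. cur1 a b * F) X P Q = E2 (- X) P * E2 (pd2 + X) Q * symbol_at pd2 X F"
proof -
  have ef: "(poly_scale (poly_scale (*)) :: 'a poly poly poly \<Rightarrow> _) = (*)"
    by (intro ext) (simp add: poly_scale_times[abs_def])
  let ?e = "subst_poly (\<lambda>h. [:[:h:]:]) X"
  note e = subst_poly_hom[OF c_hom(1), of X]
  have at_param_eq: "at_param (*) f X a b = ?e (f a b)" for f a b
    by (simp add: at_param_def ef subst_poly_altdef c_hom)
  have "S2 pd2 c = const2 c" for c :: "'a poly"
    by (induction c) (simp_all add: subst_poly_pCons[OF c_hom(2)])
  then have "S2 pd2 = (\<lambda>c :: 'a poly. const2 c)" by (rule ext)
  then have "?e F = symbol_at pd2 X F"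
    by (simp add: symbol_at_def)
  then have at: "at_param (*) (\<lambda>a b. cur1 a b * F) X a b = at_param (*) cur1 X a b * symbol_at pd2 X F" for a b
    by (simp add: at_param_eq hom_simps[OF e])
  show ?thesis
    unfolding ext_param_cur1[symmetric] unfolding ext_param_def ef at
    by (simp only: sum_distrib_right mult.assoc)
qed

text \<open>
  These are the two cocycle identities at \<open>u = v = w = 1\<close> in \<open>H\<close>, for the product with symbol \<open>1\<close>. The
  summand \<open>F(\<partial>, \<lambda> + \<mu>)\<close>, which occurs on both sides of the first identity, is cancelled.
\<close>

definition cocycle_symbol :: "'k::field poly poly \<Rightarrow> bool" where
  "cocycle_symbol F \<longleftrightarrow>
     symbol_at (pd2 + lam2) mu2 F + symbol_at pd2 lam2 F - symbol_at (- (lam2 + mu2)) lam2 F =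
     symbol_at (pd2 + mu2) lam2 F + symbol_at pd2 mu2 F - symbol_at (- (lam2 + mu2)) mu2 F \<and>
     symbol_at pd2 (lam2 + mu2) F + symbol_at (- (lam2 + mu2)) lam2 F =
     symbol_at (pd2 + mu2) lam2 F + symbol_at pd2 (- pd2 - mu2) F"

text \<open>
  The symbol \<open>t(\<partial> + \<lambda>) - t(\<partial>) + t(- \<lambda>)\<close> of \<open>d\<^sup>1\<tau>\<close>, where \<open>\<tau>\<close> is multiplication by \<open>t\<close>.
\<close>

definition coboundary_symbol :: "'k::field poly \<Rightarrow> 'k poly poly" where
  "coboundary_symbol t = subst_poly const2 (pd1 + lam1) t - [:t:] + subst_poly const2 (- lam1) t"

lemma coboundary_symbol_add: "coboundary_symbol (t + t') = coboundary_symbol t + coboundary_symbol t'"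
  by (simp add: coboundary_symbol_def hom_simps[OF subst_poly_hom[OF c_hom(1)]])

lemma coboundary_symbol_smult: "coboundary_symbol ([:c:] * t) = [:[:c:]:] * coboundary_symbol t"
proof -
  have "subst_poly const2 A [:c:] = [:[:c:]:]" for A :: "'a poly poly"
    by (simp add: subst_poly_pCons[OF c_hom(1)])
  moreover have "[:[:c:] * t:] = [:[:c:]:] * [:t:]"
    by simp
  ultimately show ?thesis
    unfolding coboundary_symbol_def hom_simps[OF subst_poly_hom[OF c_hom(1)]]
    by (simp only: distrib_left right_diff_distrib)
qed

text \<open>
  A symbol that depends on \<open>A + B\<close> only, and linearly: substituting, both sides of the first identity
  become \<open>2 \<partial> + 2 \<lambda> + 2 \<mu>\<close> and both sides of the second become \<open>\<partial> + \<lambda>\<close>, up to the factor \<open>c\<close>.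
\<close>

lemma cocycle_symbol_omega: "cocycle_symbol ([:[:c:]:] * (pd1 + lam1))"
proof -
  have S: "S2 A [:c:] = const3 c" "S2 A pd0 = A" for A :: "'a poly poly poly" and c
    by (simp add: subst_poly_pCons[OF c_hom(2)]) (rule E2_simps(3))
  have symbol: "symbol_at A B ([:[:c:]:] * (pd1 + lam1)) = const3 c * (A + B)" for A B :: "'a poly poly poly"
    unfolding hom_simps[OF symbol_at_hom]
    unfolding symbol_at_def subst_poly_pCons[OF S2_hom] S hom_simps[OF S2_hom]
    by (simp flip: one_pCons)
  show ?thesis
    unfolding cocycle_symbol_def symbol distrib_left[symmetric] right_diff_distrib[symmetric]
    by (intro conjI arg_cong[where f = "(*) (const3 c)"]) simp_all
qed

section \<open>Classification of cocycle symbols\<close>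

text \<open>
  Over an infinite field a symbol is determined by its values at pairs of scalars, which turns the
  cocycle identities into functional equations. Substituting for \<open>\<partial>\<close> first leaves a polynomial in \<open>\<lambda>\<close>
  that can be differentiated.
\<close>

abbreviation val :: "'k::comm_ring_1 poly poly \<Rightarrow> 'k \<Rightarrow> 'k \<Rightarrow> 'k" where
  "val F x \<equiv> poly (map_poly (\<lambda>c. poly c x) F)"

lemma eval_hom: "is_ring_hom (\<lambda>c. poly c x)"
  by (simp add: is_ring_hom_def)

lemma val_hom: "is_ring_hom (\<lambda>F. val F x y)"
  using subst_poly_hom[OF eval_hom, of x y] by (simp add: subst_poly_def[abs_def])

lemma val_subst: "val (subst_poly const2 A t) x y = poly t (val A x y)"
proof -
  have "val (subst_poly const2 A t) x y = subst_poly (\<lambda>c. c) (val A x y) t"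
    by (rule subst_poly_subst_poly[OF val_hom c_hom(1)]) (simp_all add: is_ring_hom_def map_poly_pCons)
  then show ?thesis by (simp add: subst_poly_def)
qed

lemma val_coboundary_symbol:
  "val (coboundary_symbol t) x y = poly t (x + y) - poly t x + poly t (- y)"
  unfolding coboundary_symbol_def hom_simps[OF val_hom] val_subst
  by (simp add: map_poly_pCons)

definition eval3 :: "'k::comm_ring_1 \<Rightarrow> 'k \<Rightarrow> 'k \<Rightarrow> 'k poly poly poly \<Rightarrow> 'k" where
  "eval3 x y z P = poly (poly (poly P [:[:z:]:]) [:y:]) x"

lemma eval3_hom: "is_ring_hom (eval3 x y z)"
  by (simp add: is_ring_hom_def eval3_def)

lemma eval3_var: "eval3 x y z pd2 = x" "eval3 x y z lam2 = y" "eval3 x y z mu2 = z"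
  by (simp_all add: eval3_def)

lemma eval3_symbol_at: "eval3 x y z (symbol_at A B F) = val F (eval3 x y z A) (eval3 x y z B)"
proof -
  have "eval3 x y z (S2 A c) = poly c (eval3 x y z A)" for c
  proof -
    have "eval3 x y z (S2 A c) = subst_poly (\<lambda>c. c) (eval3 x y z A) c"
      by (rule subst_poly_subst_poly[OF eval3_hom c_hom(2)]) (simp_all add: is_ring_hom_def eval3_def)
    then show ?thesis by (simp add: subst_poly_def)
  qed
  then have "eval3 x y z (symbol_at A B F) = subst_poly (\<lambda>c. poly c (eval3 x y z A)) (eval3 x y z B) F"
    unfolding symbol_at_def
    by (intro subst_poly_subst_poly[OF eval3_hom subst_poly_hom[OF c_hom(2)] eval_hom])
  then show ?thesis by (simp add: subst_poly_def)
qed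

lemma cocycle_symbol_val:
  assumes "cocycle_symbol F"
  shows "val F (x + y) z + val F x y - val F (- (y + z)) y = val F (x + z) y + val F x z - val F (- (y + z)) z"
    and "val F x (y + z) + val F (- (y + z)) y = val F (x + z) y + val F x (- x - z)"
proof -
  note e = hom_simps[OF eval3_hom] eval3_symbol_at eval3_var
  note c = assms[unfolded cocycle_symbol_def]
  show "val F (x + y) z + val F x y - val F (- (y + z)) y = val F (x + z) y + val F x z - val F (- (y + z)) z"
    using arg_cong[OF conjunct1[OF c], of "eval3 x y z"] unfolding e .
  show "val F x (y + z) + val F (- (y + z)) y = val F (x + z) y + val F x (- x - z)"
    using arg_cong[OF conjunct2[OF c], of "eval3 x y z"] unfolding e .
qed

lemma poly_eqI_values:
  fixes p q :: "'k::field_char_0 poly"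
  assumes "\<And>x. poly p x = poly q x"
  shows "p = q"
  using assms unfolding poly_eq_poly_eq_iff[symmetric] by (intro ext)

lemma val_eqI:
  fixes F G :: "'k::field_char_0 poly poly"
  assumes "\<And>x y. val F x y = val G x y"
  shows "F = G"
proof (rule poly_eqI)
  fix n
  have "map_poly (\<lambda>c. poly c x) F = map_poly (\<lambda>c. poly c x) G" for x
    using assms by (rule poly_eqI_values)
  then have "coeff (map_poly (\<lambda>c. poly c x) F) n = coeff (map_poly (\<lambda>c. poly c x) G) n" for x
    by (simp only:)
  then have "poly (coeff F n) x = poly (coeff G n) x" for x
    by (simp add: coeff_map_poly)
  then show "coeff F n = coeff G n"
    by (rule poly_eqI_values)
qed

lemma exists_antiderivative:
  fixes q :: "'k::field_char_0 poly"
  shows "\<exists>T. pderiv T = q"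
proof
  have "pderiv (sum f A) = (\<Sum>n\<in>A. pderiv (f n))" for f :: "nat \<Rightarrow> 'k poly" and A
    by (induction A rule: infinite_finite_induct) (simp_all add: pderiv_add)
  then show "pderiv (\<Sum>n\<le>degree q. monom (coeff q n / of_nat (Suc n)) (Suc n)) = q"
    by (simp add: pderiv_monom poly_as_sum_of_monoms del: of_nat_Suc)
qed

lemma poly_eqI_pderiv:
  fixes p q :: "'k::field_char_0 poly"
  assumes "pderiv p = pderiv q" "poly p a = poly q a"
  shows "p = q"
proof -
  have "pderiv (p - q) = 0" using assms by (simp add: pderiv_diff)
  then obtain c where c: "p - q = [:c:]"
    by (auto simp: pderiv_eq_0_iff elim: degree_eq_zeroE)
  have "c = 0" using assms(2) arg_cong[OF c, of "\<lambda>r. poly r a"] by simp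
  then show ?thesis using c by simp
qed

text \<open>
  Put \<open>h(x) = F(x,0)\<close>. The first identity at \<open>\<mu> = 0\<close> says that \<open>h(x + y) - h(x)\<close> does not depend on
  \<open>x\<close>. So \<open>h'\<close> is constant, and in characteristic zero \<open>h\<close> is affine.
\<close>

lemma cocycle_symbol_coeff_0_affine:
  fixes F :: "'k::field_char_0 poly poly"
  assumes "cocycle_symbol F"
  obtains a b where "coeff F 0 = [:a, b:]"
proof -
  define h where "h = coeff F 0"
  have val0: "val F x 0 = poly h x" for x
    by (simp add: h_def poly_0_coeff_0 coeff_map_poly)
  have *: "poly h (x + y) - val F (- y) y = poly h x - poly h (- y)" for x y
    using cocycle_symbol_val(1)[OF assms, of x y 0] by (simp add: val0)
  have diff: "poly h (x + y) = poly h x + poly h y - poly h 0" for x y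
  proof -
    have "poly h (x + y) - val F (- y) y - (poly h y - val F (- y) y) =
        poly h x - poly h (- y) - (poly h 0 - poly h (- y))"
      using *[of x y] *[of 0 y] by simp
    then show ?thesis by (simp add: algebra_simps)
  qed
  obtain b where "pderiv h = [:b:]"
  proof -
    have "pcompose h [:x, 1:] = h + [:poly h x - poly h 0:]" for x
      by (rule poly_eqI_values) (simp add: poly_pcompose diff)
    then have "pderiv (pcompose h [:x, 1:]) = pderiv h" for x
      by (simp add: pderiv_add)
    then have "poly (pderiv (pcompose h [:x, 1:])) 0 = poly (pderiv h) 0" for x
      by (simp only:)
    then have "poly (pderiv h) x = poly (pderiv h) 0" for x
      by (simp add: pderiv_pcompose pderiv_pCons poly_pcompose)
    then have "pderiv h = [:poly (pderiv h) 0:]"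
      by (intro poly_eqI_values) simp
    then show thesis by (rule that)
  qed
  then have "h = [:poly h 0, b:]"
    by - (rule poly_eqI_pderiv[where a = 0], simp_all add: pderiv_pCons)
  then show thesis using that h_def by metis
qed

text \<open>
  Write \<open>F(x,0) = a + b x\<close> and let \<open>q(x)\<close> be the derivative of \<open>F(x,\<lambda>)\<close> at \<open>\<lambda> = 0\<close>. Differentiating the
  second identity at \<open>\<lambda> = 0\<close> with \<open>\<lambda> + \<mu> = - x - y\<close> kept fixed gives
  \<open>F\<^sub>\<lambda>(x,y) = q(x + y) - q(- y) + b\<close>. The first two terms are the \<open>\<lambda>\<close>-derivative of the coboundary of
  an antiderivative \<open>t\<close> of \<open>q\<close>, the last one that of \<open>b (\<partial> + \<lambda>)\<close>. Since \<open>F(x,0)\<close> is known as well,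
  integration recovers \<open>F\<close>; the constant \<open>a\<close> is absorbed by choosing \<open>t(0) = a\<close>.
\<close>

lemma cocycle_symbol_decompose:
  fixes F :: "'k::field_char_0 poly poly"
  assumes F: "cocycle_symbol F"
  shows "\<exists>c t. F = [:[:c:]:] * (pd1 + lam1) + coboundary_symbol t"
proof -
  obtain a b where h: "coeff F 0 = [:a, b:]"
    using cocycle_symbol_coeff_0_affine[OF F] .
  define q where "q = coeff F 1"
  obtain T where T: "pderiv T = q"
    using exists_antiderivative by blast
  define sl where "sl x = map_poly (\<lambda>c. poly c x) F" for x
  have sl0: "poly (sl x) 0 = a + b * x" and sl1: "poly (pderiv (sl x)) 0 = poly q x" for x
    by (simp_all add: sl_def poly_0_coeff_0 coeff_pderiv coeff_map_poly h q_def algebra_simps)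
  have deriv: "poly (pderiv (sl x)) y = poly q (x + y) - poly q (- y) + b" for x y
  proof -
    define \<sigma> where "\<sigma> = - x - y"
    obtain F1 where F1: "F = pCons [:a, b:] F1"
      by (metis h coeff_pCons_0 pCons_cases)
    have q: "q = coeff F1 0" by (simp add: q_def F1)
    \<comment> \<open>The line \<open>\<lambda> + \<mu> = \<sigma>\<close> is parametrized by \<open>\<lambda> = z\<close>. On it \<open>F(\<partial> + \<mu>, \<lambda>)\<close> is \<open>P(z)\<close>; splitting off the
      constant coefficient of \<open>F\<close> leaves a factor \<open>z\<close>, so that \<open>P'(0)\<close> involves no derivative of the rest.\<close>
    let ?line = "[:x + \<sigma>, -1:]"
    define P where "P = pcompose [:a, b:] ?line + [:0, 1:] * poly (map_poly (\<lambda>c. pcompose c ?line) F1) [:0, 1:]"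
    have comp_val: "poly (poly (map_poly (\<lambda>c. pcompose c l) G) [:0, 1:]) z = val G (poly l z) z" for l :: "'k poly" and G z
    proof (induction G)
      case 0 then show ?case by simp
    next
      case (pCons c G)
      then show ?case by (simp add: map_poly_pCons poly_pcompose)
    qed
    have val_P: "poly P z = val F (x + \<sigma> - z) z" for z
      using comp_val[where l = ?line and G = F1 and z = z]
      by (simp add: P_def F1 map_poly_pCons poly_pcompose algebra_simps)
    have "[:val F x \<sigma>:] + sl (- \<sigma>) = P + pcompose (sl x) [:y, 1:]"
    proof (rule poly_eqI_values)
      fix z
      show "poly ([:val F x \<sigma>:] + sl (- \<sigma>)) z = poly (P + pcompose (sl x) [:y, 1:]) z"
        using cocycle_symbol_val(2)[OF F, of x z "\<sigma> - z"]
        unfolding poly_add val_P by (simp add: sl_def poly_pcompose \<sigma>_def algebra_simps)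
    qed
    then have "pderiv ([:val F x \<sigma>:] + sl (- \<sigma>)) = pderiv (P + pcompose (sl x) [:y, 1:])"
      by (rule arg_cong)
    then have "poly (pderiv ([:val F x \<sigma>:] + sl (- \<sigma>))) 0 = poly (pderiv (P + pcompose (sl x) [:y, 1:])) 0"
      by (rule arg_cong)
    moreover have "poly (pderiv P) 0 = poly q (- y) - b"
    proof -
      have "poly (poly (map_poly (\<lambda>c. pcompose c ?line) F1) [:0, 1:]) 0 = poly q (- y)"
        unfolding comp_val by (simp add: q poly_0_coeff_0 coeff_map_poly \<sigma>_def)
      then show ?thesis
        by (simp add: P_def pderiv_add pderiv_mult pderiv_pCons pcompose_pCons)
    qed
    ultimately show ?thesis
      by (simp add: pderiv_add pderiv_pcompose poly_pcompose pderiv_pCons sl1 \<sigma>_def algebra_simps)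
  qed
  define t where "t = T + [:a - poly T 0:]"
  have pt: "pderiv t = q" "poly t 0 = a"
    by (simp_all add: t_def pderiv_add T)
  have "F = [:[:b:]:] * (pd1 + lam1) + coboundary_symbol t"
  proof (rule val_eqI)
    fix x y
    \<comment> \<open>The right-hand side at \<open>\<partial> = x\<close>, as a polynomial in \<open>\<lambda>\<close>.\<close>
    let ?R = "pcompose t [:x, 1:] - [:poly t x:] + pcompose t [:0, -1:] + [:b * x, b:]"
    have "sl x = ?R"
    proof (rule poly_eqI_pderiv[where a = 0])
      show "poly (sl x) 0 = poly ?R 0"
        by (simp add: sl0 poly_pcompose pt)
      show "pderiv (sl x) = pderiv ?R"
        by (rule poly_eqI_values) (simp add: deriv pderiv_add pderiv_diff
            pderiv_pcompose poly_pcompose pderiv_pCons pt)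
    qed
    then have "val F x y = poly ?R y" by (simp add: sl_def)
    then show "val F x y = val ([:[:b:]:] * (pd1 + lam1) + coboundary_symbol t) x y"
      unfolding hom_simps[OF val_hom] val_coboundary_symbol
      by (simp add: map_poly_pCons poly_pcompose algebra_simps)
  qed
  then show ?thesis by blast
qed

text \<open>
  At \<open>\<lambda> = 0\<close> every coboundary symbol is the constant \<open>t(0)\<close>, whereas \<open>\<partial> + \<lambda>\<close> becomes \<open>\<partial>\<close>.
\<close>

lemma omega_not_coboundary: "pd1 + lam1 \<noteq> coboundary_symbol (t :: 'k::field poly)"
proof
  assume *: "pd1 + lam1 = coboundary_symbol t"
  have "val (pd1 + lam1) x 0 = val (coboundary_symbol t) x 0" for x
    by (simp only: *)
  from this[of 1] this[of 0] show False
    unfolding val_coboundary_symbol hom_simps[OF val_hom] by (simp add: map_poly_pCons)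
qed

section \<open>The isomorphism between \<open>H\<close> and \<open>Cur\<^sub>1\<close>\<close>

context Cur1
begin

definition emb :: "'k poly \<Rightarrow> 'v" where "emb a = s a v"

lemma emb_add: "emb (a + b) = emb a + emb b"
  by (simp add: emb_def scale_left_distrib)

lemma emb_mult: "emb (h * a) = s h (emb a)"
  by (simp add: emb_def)

lemma bij_emb: "bij emb"
proof (rule bijI)
  have "a = b" if "emb a = emb b" for a b
  proof -
    have "s (a - b) v = 0" using that by (simp add: emb_def scale_left_diff_distrib)
    then have "a - b = 0"
      using independent[unfolded independent_explicit_module, rule_format, of "{v}" "\<lambda>_. a - b" v]
      by simp
    then show ?thesis by simp
  qed
  then show "inj emb" by (rule injI)
  show "surj emb" using span unfolding span_singleton emb_def[abs_def] .
qed

definition coord :: "'v \<Rightarrow> 'k poly" where "coord = inv emb"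

lemma coord_emb: "coord (emb a) = a" and emb_coord: "emb (coord u) = u"
  using bij_emb unfolding coord_def by (simp_all add: bij_is_inj bij_is_surj surj_f_inv_f)

abbreviation "emb1 \<equiv> map_poly emb"

abbreviation "emb2 \<equiv> map_poly emb1"

lemma emb_0: "emb 0 = 0" by (simp add: emb_def)

lemmas emb1_hom = map_poly_hom[of emb, OF emb_add]

lemmas emb2_hom = map_poly_hom[of emb1, OF emb1_hom(1)]

lemma coord_0: "coord 0 = 0"
  using coord_emb[of 0] unfolding emb_0 .

lemma emb1_coord: "emb1 (map_poly coord p) = p"
  by (rule poly_eqI) (simp add: coeff_map_poly emb_0 coord_0 emb_coord)

lemma coord_emb1: "map_poly coord (emb1 p) = p"
  by (rule poly_eqI) (simp add: coeff_map_poly emb_0 coord_0 coord_emb)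

lemma inj_emb1: "inj emb1"
  by (metis injI coord_emb1)

lemma inj_emb2: "inj emb2"
  by (rule inj_on_inverseI[of _ "map_poly (map_poly coord)"], rule poly_eqI)
    (simp add: coeff_map_poly coord_emb1)

lemma poly_scale_emb1: "poly_scale s P (emb1 p) = emb1 (P * p)"
  by (intro poly_scale_transport emb_add bij_is_inj[OF bij_emb] emb_mult)

lemma poly_scale_emb2: "poly_scale (poly_scale s) P (emb2 p) = emb2 (P * p)"
  by (intro poly_scale_transport emb1_hom inj_emb1 poly_scale_emb1[symmetric])

lemma degree_emb: "degree (emb1 p) = degree p" "degree (emb2 P) = degree P"
proof -
  have "emb a \<noteq> 0" if "a \<noteq> 0" for a
    using that emb_0 by (metis coord_emb)
  then show "degree (emb1 p) = degree p"
    by (cases "p = 0") (simp_all add: degree_map_poly)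
  have "emb1 a \<noteq> 0" if "a \<noteq> 0" for a
    using that inj_emb1 by (metis injD map_poly_0)
  then show "degree (emb2 P) = degree P"
    by (cases "P = 0") (simp_all add: degree_map_poly)
qed

text \<open>
  All operations on \<open>V\<close>, \<open>V[\<lambda>]\<close> and \<open>V[\<lambda>,\<mu>]\<close> are defined coefficientwise, so the isomorphism
  \<open>H \<cong> V\<close>, \<open>a \<mapsto> a v\<close>, carries computations with \<open>g\<close> on \<open>H\<close> to computations with \<open>f\<close> on \<open>V\<close>.
\<close>

lemma ext_param_emb:
  assumes f: "\<And>a b. f (emb a) (emb b) = emb1 (g a b)"
  shows "ext_param s f X (emb2 P) (emb2 Q) = emb2 (ext_param (*) g X P Q)"
proof -
  have ef: "(poly_scale (poly_scale (*)) :: 'k poly poly poly \<Rightarrow> _) = (*)"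
    by (intro ext) (simp add: poly_scale_times[abs_def])
  have c: "const2 (emb a) = emb2 (const2 a)" for a
    by (simp add: map_poly_pCons emb_0)
  have "at_param s f X (emb a) (emb b) = emb2 (at_param (*) g X a b)" for a b
    by (simp add: at_param_def f degree_emb coeff_map_poly emb_0 c poly_scale_emb2 emb2_hom(3) ef del: map_poly_pCons)
  then show ?thesis
    by (simp add: ext_param_def degree_emb coeff_map_poly emb_0 poly_scale_emb2 emb2_hom(3) ef)
qed

section \<open>Cochains on \<open>Cur\<^sub>1\<close> and their symbols\<close>

definition of_symbol :: "'k poly poly \<Rightarrow> 'v \<Rightarrow> 'v \<Rightarrow> 'v poly" where
  "of_symbol F u w = emb1 (cur1 (coord u) (coord w) * F)"

lemma of_symbol_emb: "of_symbol F (emb a) (emb b) = emb1 (cur1 a b * F)"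
  by (simp add: of_symbol_def coord_emb)

lemma cur1_1_1: "cur1 1 1 = (1 :: 'k poly poly)"
  by (simp add: cur1_def hom_simps[OF subst_poly_hom[OF c_hom(1)]])

lemma emb_1: "emb 1 = v"
  by (simp add: emb_def)

lemma of_symbol_generator: "of_symbol F v v = emb1 F"
  using of_symbol_emb[of F 1 1] by (simp add: cur1_1_1 emb_1)

lemma coord_simps: "coord (a + b) = coord a + coord b" "coord (s h a) = h * coord a"
  using coord_emb[of "coord a + coord b"] coord_emb[of "h * coord a"]
  by (simp_all add: emb_add emb_mult emb_coord)

lemma of_symbol_eq_iff: "of_symbol F = of_symbol G \<longleftrightarrow> F = G"
  by (metis inj_emb1 injD of_symbol_generator)

text \<open>
  Linearity over the base field presupposes vector space structures on \<open>V\<close> and \<open>V[\<lambda>]\<close>; these are the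
  ones that sesquilinearity of the product already provides.
\<close>

lemma sesquilinear_of_symbol: "sesquilinear s (of_symbol F)"
proof -
  note c = sesquilinear_simps[OF sesquilinear_cur1, unfolded poly_scale_times]
  have [simp]: "of_symbol F (a + b) w = of_symbol F a w + of_symbol F b w" "of_symbol F w (a + b) = of_symbol F w a + of_symbol F w b" for a b w
    by (simp_all add: of_symbol_def coord_simps c ring_distribs emb1_hom)
  have sc: "of_symbol F (s [:k:] a) w = poly_scale s [:[:k:]:] (of_symbol F a w)"
      "of_symbol F w (s [:k:] a) = poly_scale s [:[:k:]:] (of_symbol F w a)"
      "of_symbol F (s pd0 a) w = poly_scale s (- lam1) (of_symbol F a w)"
      "of_symbol F w (s pd0 a) = poly_scale s (pd1 + lam1) (of_symbol F w a)" for a w k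
    unfolding of_symbol_def coord_simps c poly_scale_emb1 by (simp_all only: mult.assoc)
  show ?thesis
    using sesquilinear
    unfolding sesquilinear_def Vector_Spaces.linear_def module_hom_def module_hom_axioms_def
    by (simp add: sc)
qed

lemma sesquilinear_imp_of_symbol:
  assumes "sesquilinear s f"
  shows "f = of_symbol (map_poly coord (f v v))"
  by (rule sesquilinear_eqI[OF module_axioms assms sesquilinear_of_symbol span])
    (simp add: of_symbol_generator emb1_coord)

lemma m_eq_of_symbol: "m = of_symbol 1"
proof (rule sesquilinear_eqI[OF module_axioms sesquilinear sesquilinear_of_symbol span])
  show "m v v = of_symbol 1 v v"
    unfolding mult of_symbol_generator pCons_one[symmetric] map_poly_pCons[of emb, OF emb_0]
    by (simp only: pCons_one emb_1 map_poly_0)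
qed

lemma of_symbol_add: "of_symbol (F + G) = of_symbol F + of_symbol G"
  by (intro ext) (simp add: of_symbol_def ring_distribs emb1_hom)

lemma scale_map_of_symbol: "scale_map s c (of_symbol F) = of_symbol ([:[:c:]:] * F)"
  unfolding scale_map_def of_symbol_def poly_scale_emb1 by (simp only: mult_ac)

lemma Z2_imp_sesquilinear: "f \<in> Z2 s m \<Longrightarrow> sesquilinear s f"
  by (simp add: Z2_def)

text \<open>
  Every term of the cocycle identities at \<open>a v\<close>, \<open>b v\<close>, \<open>c v\<close> has the common factor
  \<open>a(- \<lambda>) b(- \<mu>) c(\<partial> + \<lambda> + \<mu>)\<close>. So the identities hold for all arguments as soon as the cofactors
  agree, and the arguments \<open>v\<close>, \<open>v\<close>, \<open>v\<close> show that the cofactors must agree.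
\<close>

lemma of_symbol_in_Z2_iff: "of_symbol F \<in> Z2 s m \<longleftrightarrow> cocycle_symbol F"
proof -
  have F: "ext_param s (of_symbol F) X (emb2 P) (emb2 Q) =
      emb2 (E2 (- X) P * E2 (pd2 + X) Q * symbol_at pd2 X F)" for F X P Q
    by (subst ext_param_emb[where g = "\<lambda>a b. cur1 a b * F"]) (simp_all only: of_symbol_emb ext_param_symbol)
  have M: "ext_param s m X (emb2 P) (emb2 Q) = emb2 (E2 (- X) P * E2 (pd2 + X) Q)" for X P Q
    unfolding m_eq_of_symbol F hom_simps[OF symbol_at_hom] by simp
  have c: "const2 (emb a) = emb2 (const2 a)" for a
    by (simp add: map_poly_pCons emb_0)
  let ?p = "\<lambda>a b c. S2 (- lam2) a * S2 (- mu2) b * S2 (pd2 + (lam2 + mu2)) c"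
  let ?lhs = "symbol_at (pd2 + lam2) mu2 F + symbol_at pd2 lam2 F - symbol_at (- (lam2 + mu2)) lam2 F - symbol_at pd2 (lam2 + mu2) F"
  let ?rhs = "symbol_at (pd2 + mu2) lam2 F + symbol_at pd2 mu2 F - symbol_at (- (lam2 + mu2)) mu2 F - symbol_at pd2 (lam2 + mu2) F"
  let ?lhs2 = "symbol_at pd2 (lam2 + mu2) F + symbol_at (- (lam2 + mu2)) lam2 F"
  let ?rhs2 = "symbol_at (pd2 + mu2) lam2 F + symbol_at pd2 (- pd2 - mu2) F"
  note e = hom_simps[OF E2_hom] hom_simps[OF S2_hom] E2_simps E2_symbol_at
  have pd: "E2 Y pd2 = Y" for Y :: "'k poly poly poly"
    unfolding E2_simps(5) E2_simps(3) ..
  \<comment> \<open>The values of \<open>\<partial>\<close> produced by the nested substitutions, written so that \<open>?p\<close> becomes visible.\<close>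
  have x: "- (lam2 + mu2) + mu2 = (- lam2 :: 'k poly poly poly)" "- (lam2 + mu2) + lam2 = (- mu2 :: 'k poly poly poly)"
     "- (- pd2 - mu2) = (pd2 + mu2 :: 'k poly poly poly)"
     "pd2 + (- pd2 - mu2) = (- mu2 :: 'k poly poly poly)"
     "pd2 + mu2 + lam2 = (pd2 + (lam2 + mu2) :: 'k poly poly poly)"
     "pd2 + lam2 + mu2 = (pd2 + (lam2 + mu2) :: 'k poly poly poly)"
    by simp_all
  \<comment> \<open>The cofactors of the first identity still contain \<open>F(\<partial>, \<lambda> + \<mu>)\<close> on both sides, which makes them
    match the definition of \<open>Z\<^sup>2\<close> term by term.\<close>
  have "of_symbol F \<in> Z2 s m \<longleftrightarrow> (\<forall>a b c. ?p a b c * ?lhs = ?p a b c * ?rhs \<and> ?p a b c * ?lhs2 = ?p a b c * ?rhs2)"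
  proof -
    have all: "(\<forall>u. P u) \<longleftrightarrow> (\<forall>a. P (emb a))" for P :: "'v \<Rightarrow> bool"
      by (metis emb_coord)
    have "of_symbol F \<in> Z2 s m \<longleftrightarrow> (\<forall>a b c. emb2 (?p a b c * ?lhs) = emb2 (?p a b c * ?rhs) \<and> emb2 (?p a b c * ?lhs2) = emb2 (?p a b c * ?rhs2))"
      unfolding Z2_def mem_Collect_eq Let_def
      apply (simp only: sesquilinear_of_symbol simp_thms)
      unfolding all c F M e pd x
      unfolding emb2_hom(1,2)[symmetric]
      by (simp only: algebra_simps)
    then show ?thesis by (simp only: inj_eq[OF inj_emb2])
  qed
  also have "\<dots> \<longleftrightarrow> ?lhs = ?rhs \<and> ?lhs2 = ?rhs2"
  proof -
    have "?p 1 1 1 = 1" by (simp add: e)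
    then show ?thesis by (metis mult_1)
  qed
  also have "\<dots> \<longleftrightarrow> cocycle_symbol F"
  proof -
    have "x - z = y - z \<longleftrightarrow> x = y" for x y z :: "'k poly poly poly" by simp
    then show ?thesis unfolding cocycle_symbol_def by (simp only:)
  qed
  finally show ?thesis .
qed

text \<open>
  An \<open>H\<close>-linear map \<open>\<tau>\<close> on the free module \<open>Hv\<close> is multiplication by the \<open>t\<close> with \<open>\<tau>(v) = t v\<close>, and
  every \<open>t\<close> occurs.
\<close>

lemma B2_eq: "B2 s m = of_symbol ` range coboundary_symbol"
proof -
  have d1: "d1 m \<tau> = of_symbol (coboundary_symbol t)" if \<tau>: "module_hom s s \<tau>" and t: "\<tau> v = emb t" for \<tau> t
  proof (intro ext)
    fix u w
    interpret \<tau>: module_hom s s \<tau> by fact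
    have \<tau>_emb: "\<tau> (emb a) = emb (t * a)" for a
      unfolding emb_mult t[symmetric] mult.commute[of t a] by (simp add: emb_def \<tau>.scale)
    have \<tau>_emb1: "map_poly \<tau> (emb1 p) = emb1 ([:t:] * p)" for p
      by (intro poly_eqI) (simp add: coeff_map_poly \<tau>.zero emb_0 \<tau>_emb)
    obtain a b where [simp]: "u = emb a" "w = emb b" by (metis emb_coord)
    note h = hom_simps[OF subst_poly_hom[OF c_hom(1)]]
    show "d1 m \<tau> u w = of_symbol (coboundary_symbol t) u w"
      unfolding d1_def m_eq_of_symbol by (simp add: \<tau>_emb of_symbol_emb \<tau>_emb1 coboundary_symbol_def cur1_def h algebra_simps flip: emb1_hom)
  qed
  have "\<exists>\<tau>. module_hom s s \<tau> \<and> \<tau> v = emb t" for t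
  proof (intro exI conjI)
    show "module_hom s s (\<lambda>u. emb (t * coord u))"
      by unfold_locales (simp_all add: coord_simps ring_distribs emb_add emb_mult mult.left_commute scale_left_commute)
    show "emb (t * coord v) = emb t"
      using coord_emb[of 1] unfolding emb_1 by simp
  qed
  then show ?thesis
    unfolding B2_def using d1 emb_coord by (auto simp: image_iff; metis)
qed

section \<open>The second cohomology space\<close>

lemma mem_B2_iff: "f \<in> B2 s m \<longleftrightarrow> (\<exists>t. f = of_symbol (coboundary_symbol t))"
  by (auto simp: B2_eq)

lemma mem_B2_coset_iff: "f \<in> of_symbol F +o B2 s m \<longleftrightarrow> (\<exists>t. f = of_symbol (F + coboundary_symbol t))"
  by (auto simp: B2_eq elt_set_plus_def of_symbol_add)

lemma B2_coset_eq: "of_symbol (F + coboundary_symbol t) +o B2 s m = of_symbol F +o B2 s m"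
proof (intro set_eqI iffI)
  fix f assume "f \<in> of_symbol (F + coboundary_symbol t) +o B2 s m"
  then obtain t' where "f = of_symbol (F + coboundary_symbol (t + t'))"
    by (auto simp: mem_B2_coset_iff coboundary_symbol_add add.assoc)
  then show "f \<in> of_symbol F +o B2 s m"
    unfolding mem_B2_coset_iff by blast
next
  fix f assume "f \<in> of_symbol F +o B2 s m"
  then obtain t' where "f = of_symbol (F + coboundary_symbol (t + (t' - t)))"
    by (auto simp: mem_B2_coset_iff)
  then show "f \<in> of_symbol (F + coboundary_symbol t) +o B2 s m"
    unfolding mem_B2_coset_iff coboundary_symbol_add add.assoc by blast
qed

text \<open>
  Scaling maps coboundaries to coboundaries because \<open>t \<mapsto> t(\<partial> + \<lambda>) - t(\<partial>) + t(- \<lambda>)\<close> is linear over the field.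
\<close>

lemma scale_class_coset:
  "scale_class s m c (of_symbol F +o B2 s m) = of_symbol ([:[:c:]:] * F) +o B2 s m"
proof -
  have scale: "scale_map s c (of_symbol (F + coboundary_symbol t)) + of_symbol (coboundary_symbol t') =
      of_symbol ([:[:c:]:] * F + coboundary_symbol ([:c:] * t + t'))" for t t'
    unfolding coboundary_symbol_add coboundary_symbol_smult of_symbol_add[symmetric] scale_map_of_symbol
    by (simp only: distrib_left add.assoc)
  have "f \<in> scale_class s m c (of_symbol F +o B2 s m) \<longleftrightarrow>
      (\<exists>t t'. f = scale_map s c (of_symbol (F + coboundary_symbol t)) + of_symbol (coboundary_symbol t'))" for f
    unfolding scale_class_def set_plus_def mem_Collect_eq Bex_def image_iff mem_B2_iff mem_B2_coset_iff
    by blast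
  then have "f \<in> scale_class s m c (of_symbol F +o B2 s m) \<longleftrightarrow>
      (\<exists>t t'. f = of_symbol ([:[:c:]:] * F + coboundary_symbol ([:c:] * t + t')))" for f
    unfolding scale .
  \<comment> \<open>For \<open>c = 0\<close> scaling alone reaches a single map; the added coboundary \<open>t'\<close> fills up the coset.\<close>
  moreover have "(\<exists>t t'. P ([:c:] * t + t')) \<longleftrightarrow> (\<exists>t. P t)" for P :: "'k poly \<Rightarrow> bool"
    by (metis add_0 mult_zero_right)
  ultimately show ?thesis
    by (intro set_eqI) (simp only: mem_B2_coset_iff)
qed

end

theorem theorem4:
  fixes s :: "'k::field_char_0 poly \<Rightarrow> 'v::ab_group_add \<Rightarrow> 'v"
    and m :: "'v \<Rightarrow> 'v \<Rightarrow> 'v poly" and v :: 'v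
  assumes "Cur1 s m v"
  shows "\<exists>\<omega>. \<omega> \<in> Z2 s m \<and> \<omega> v v = poly_scale s (pd1 + lam1) [:v:] \<and>
           (\<forall>\<omega>'. \<omega>' \<in> Z2 s m \<and> \<omega>' v v = poly_scale s (pd1 + lam1) [:v:] \<longrightarrow> \<omega>' = \<omega>) \<and>
           H2 s m = {scale_class s m c (\<omega> +o B2 s m) | c. True} \<and>
           \<omega> +o B2 s m \<noteq> B2 s m"
proof -
  interpret Cur1 s m v by fact
  let ?w = "pd1 + lam1 :: 'k poly poly"
  have cocycle: "of_symbol ([:[:c:]:] * ?w) \<in> Z2 s m" for c
    unfolding of_symbol_in_Z2_iff by (rule cocycle_symbol_omega)
  have w: "of_symbol ?w \<in> Z2 s m"
    using cocycle[of 1] by (simp only: pCons_one mult_1)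
  have w_val: "of_symbol ?w v v = poly_scale s ?w [:v:]"
  proof -
    have "emb1 1 = [:v:]"
      using mult unfolding m_eq_of_symbol of_symbol_generator .
    then show ?thesis
      using poly_scale_emb1[of ?w 1] by (simp only: of_symbol_generator mult_1_right)
  qed
  have Z2_of_symbol: "\<exists>F. f = of_symbol F \<and> cocycle_symbol F" if "f \<in> Z2 s m" for f
    using that sesquilinear_imp_of_symbol[OF Z2_imp_sesquilinear] of_symbol_in_Z2_iff by metis
  have unique: "f = of_symbol ?w" if "f \<in> Z2 s m" "f v v = poly_scale s ?w [:v:]" for f
    using that w_val
    by (intro sesquilinear_eqI[OF module_axioms Z2_imp_sesquilinear sesquilinear_of_symbol span]) simp_all
  have "H2 s m = {scale_class s m c (of_symbol ?w +o B2 s m) | c. True}"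
  proof (intro equalityI subsetI)
    fix A assume "A \<in> H2 s m"
    then obtain F where F: "cocycle_symbol F" "A = of_symbol F +o B2 s m"
      using Z2_of_symbol unfolding H2_def by blast
    then obtain c t where "F = [:[:c:]:] * ?w + coboundary_symbol t"
      using cocycle_symbol_decompose by blast
    then show "A \<in> {scale_class s m c (of_symbol ?w +o B2 s m) | c. True}"
      using F(2) B2_coset_eq scale_class_coset by blast
  next
    fix A assume "A \<in> {scale_class s m c (of_symbol ?w +o B2 s m) | c. True}"
    then show "A \<in> H2 s m"
      using cocycle scale_class_coset unfolding H2_def by blast
  qed
  moreover have "of_symbol ?w +o B2 s m \<noteq> B2 s m"
  proof
    assume eq: "of_symbol ?w +o B2 s m = B2 s m"
    have "coboundary_symbol (0 :: 'k poly) = 0"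
      by (simp add: coboundary_symbol_def)
    then have "of_symbol ?w + of_symbol 0 \<in> of_symbol ?w +o B2 s m"
      unfolding B2_eq by (intro set_plus_intro2) (metis imageI rangeI)
    then have "of_symbol ?w \<in> B2 s m"
      unfolding eq of_symbol_add[symmetric] by simp
    then show False
      unfolding B2_eq using of_symbol_eq_iff omega_not_coboundary by blast
  qed
  ultimately show ?thesis
    using w w_val unique by blast
qed

end
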